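(* For every integer $k\ge 1$ there exists a graph $G_k \in \mathcal{G}_{\mathrm{seg}}$ on $4k^2$ vertices with clique covering number $\theta(G_k) = 2k^2$, fractional independence number $\alpha^\star(G_k)=2k^2$, and independence number \[ \alpha(G_k) = k^2+3k-2. \]
   Context: $\mathcal{G}_{\mathrm{seg}}$ denotes the class of graphs that are intersection graphs of finite families of axis-parallel (horizontal or vertical) segments in the plane in which no three segments have a common point. The intersection graph of a family of segments has the segments as vertices, two being adjacent if and only if they intersect. $\alpha(G)$ is the independence number. $\theta(G)$ is the minimum number of parts in a partition of $V(G)$ into cliques. $\alpha^\star(G)$ is the maximum of $\sum_{u} x_u$ over $x\in[0,1]^{V(G)}$ with $x_u+x_v\le 1$ for every edge $uv$. *)

theory Defs
  imports "HOL-Analysis.Analysis" "HOL-Library.Disjoint_Sets"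
begin

record 'a graph =
  vertices :: "'a set"
  edges :: "'a set set"

definition clique :: "'a graph \<Rightarrow> 'a set \<Rightarrow> bool" where
  "clique G C \<longleftrightarrow> C \<subseteq> vertices G \<and> (\<forall>u\<in>C. \<forall>v\<in>C. u \<noteq> v \<longrightarrow> {u, v} \<in> edges G)"

definition independent_set :: "'a graph \<Rightarrow> 'a set \<Rightarrow> bool" where
  "independent_set G S \<longleftrightarrow> S \<subseteq> vertices G \<and> (\<forall>u\<in>S. \<forall>v\<in>S. {u, v} \<notin> edges G)"

(* The three parameters below are meaningful for graphs with finitely many vertices only. *)

definition independence_number :: "'a graph \<Rightarrow> nat" where
  "independence_number G = Max {card S | S. independent_set G S}"

definition clique_covering_number :: "'a graph \<Rightarrow> nat" where
  "clique_covering_number G =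
     (LEAST n. \<exists>P. partition_on (vertices G) P \<and> (\<forall>C\<in>P. clique G C) \<and> card P = n)"

definition fractional_independent :: "'a graph \<Rightarrow> ('a \<Rightarrow> real) \<Rightarrow> bool" where
  "fractional_independent G x \<longleftrightarrow>
     (\<forall>u\<in>vertices G. 0 \<le> x u \<and> x u \<le> 1) \<and>
     (\<forall>u v. {u, v} \<in> edges G \<longrightarrow> x u + x v \<le> 1)"

(* The greatest value is attained: for finite graphs the feasible region is a nonempty polytope. *)
definition fractional_independence_number :: "'a graph \<Rightarrow> real" where
  "fractional_independence_number G =
     (GREATEST r. \<exists>x. fractional_independent G x \<and> r = (\<Sum>u\<in>vertices G. x u))"

(* Segments are closed and have distinct endpoints. *)
definition axis_parallel_segment :: "(real \<times> real) set \<Rightarrow> bool" where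
  "axis_parallel_segment T \<longleftrightarrow>
     (\<exists>a b. a \<noteq> b \<and> (fst a = fst b \<or> snd a = snd b) \<and> T = closed_segment a b)"

definition intersection_graph :: "'a set \<Rightarrow> ('a \<Rightarrow> 'b set) \<Rightarrow> 'a graph" where
  "intersection_graph I s =
     \<lparr>vertices = I, edges = {{u, v} | u v. u \<in> I \<and> v \<in> I \<and> u \<noteq> v \<and> s u \<inter> s v \<noteq> {}}\<rparr>"

(* A family of segments is indexed by the vertices of its graph, so the class is closed
   under isomorphism. *)
definition seg_graphs :: "'a graph set" where
  "seg_graphs = {intersection_graph I s | I (s :: 'a \<Rightarrow> (real \<times> real) set).
     finite I \<and>
     (\<forall>i\<in>I. axis_parallel_segment (s i)) \<and>
     (\<forall>i\<in>I. \<forall>j\<in>I. \<forall>l\<in>I. i \<noteq> j \<and> i \<noteq> l \<and> j \<noteq> l \<longrightarrow> s i \<inter> s j \<inter> s l = {})}"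

end

theory Submission
  imports Defs
begin

text \<open>Put a centre of two horizontal arms (left, right) and a centre of two vertical arms (down, up)
  into each cell of a \<open>k\<close> by \<open>k\<close> grid, the vertical centre to the lower left of the horizontal one,
  perturbed so that no two centres share a supporting line. Opposite arms touch at their centre only,
  so the graph is triangle free and has a perfect matching, whatever the lengths of the arms are; this
  gives both \<open>2 k\<^sup>2\<close> claims.

  If all arms are long, choose pairwise disjoint arms and call a row free at a column if no chosen
  vertical arm of the column crosses it. A column with \<open>f\<close> free rows has at most \<open>k + 1 - f\<close> chosen
  vertical arms, and a row that is free at \<open>f\<close> columns has at most \<open>f + 1\<close> chosen horizontal arms. Hence
  the independence number is at most \<open>k\<^sup>2 + 2 k\<close>. If all arms are short, it is at least \<open>2 k\<^sup>2\<close>.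
  Shortening the arms one at a time changes the neighbourhood of one vertex, hence raises the independence
  number by at most one, so the value \<open>k\<^sup>2 + 3 k - 2\<close> is attained on the way.\<close>

section \<open>Counting bound for pairwise disjoint long arms\<close>

lemma card_indicator_sum:
  fixes n :: nat
  shows "(\<Sum>i<n. of_bool (P i)) = card {i. i < n \<and> P i}"
  by (simp add: sum.If_cases of_bool_def lessThan_def Int_def flip: Collect_conj_eq)

lemma card_subset_insert_le:
  assumes "A \<subseteq> insert x B" "finite B"
  shows "card A \<le> card B + 1"
  using card_mono[OF _ assms(1)] assms(2) card_insert_if[of B x]
  by (auto split: if_splits)

text \<open>\<open>L\<close>, \<open>R\<close>, \<open>T\<close>, \<open>B\<close> mark the chosen
  left, right, up and down arms of column \<open>a\<close> and row \<open>b\<close>. A vertical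
  centre is to the lower left of the horizontal centre of its cell, whence the mix of weak and
  strict inequalities. Summing \<open>column\<close> over columns and \<open>row\<close> over rows
  cancels the free pairs and leaves \<open>k * (k + 1) + k\<close>.\<close>

lemma no_crossing_arms_bound:
  fixes k :: nat and L R T B :: "nat \<Rightarrow> nat \<Rightarrow> bool"
  assumes LR: "\<And>a b. \<not> (L a b \<and> R a b)"
    and TB: "\<And>a b. \<not> (T a b \<and> B a b)"
    and LT: "\<And>a b a' b'. \<lbrakk>L a b; T a' b'; a' \<le> a; b' \<le> b; a < k; b < k\<rbrakk> \<Longrightarrow> False"
    and LB: "\<And>a b a' b'. \<lbrakk>L a b; B a' b'; a' \<le> a; b < b'; a < k; b' < k\<rbrakk> \<Longrightarrow> False"
    and RT: "\<And>a b a' b'. \<lbrakk>R a b; T a' b'; a < a'; b' \<le> b; a' < k; b < k\<rbrakk> \<Longrightarrow> False"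
    and RB: "\<And>a b a' b'. \<lbrakk>R a b; B a' b'; a < a'; b < b'; a' < k; b' < k\<rbrakk> \<Longrightarrow> False"
  shows "(\<Sum>a<k. \<Sum>b<k. of_bool (L a b) + of_bool (R a b) + of_bool (T a b) + of_bool (B a b))
           \<le> k\<^sup>2 + 2 * k"
proof -
  \<comment> \<open>\<open>F a b\<close>: no chosen vertical arm of column \<open>a\<close> meets the horizontal lines of row \<open>b\<close>.\<close>
  define F where "F a b \<longleftrightarrow> (\<forall>b'\<le>b. \<not> T a b') \<and> (\<forall>b'. b < b' \<and> b' < k \<longrightarrow> \<not> B a b')" for a b
  have column: "(\<Sum>b<k. of_bool (T a b)) + (\<Sum>b<k. of_bool (B a b)) + (\<Sum>b<k. of_bool (F a b))
      \<le> k + (1::nat)" for a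
  proof -
    let ?T = "{b. b < k \<and> T a b}" and ?B = "{b. b < k \<and> B a b}" and ?F = "{b. b < k \<and> F a b}"
    \<comment> \<open>A down arm misses the horizontal lines of its own row but crosses those of all
      lower rows, so only the topmost chosen one can have a free row.\<close>
    have "card (?B \<inter> ?F) \<le> 1"
      by (subst One_nat_def, subst card_le_Suc0_iff_eq) (auto simp: F_def, metis nat_neq_iff)
    moreover have "card ?B + card ?F = card (?B \<union> ?F) + card (?B \<inter> ?F)"
      by (rule card_Un_Int) auto
    moreover have "card ?T + card (?B \<union> ?F) = card (?T \<union> (?B \<union> ?F))"
      using TB by (intro card_Un_disjoint[symmetric]) (auto simp: F_def)
    moreover have "card (?T \<union> (?B \<union> ?F)) \<le> card {..<k}"
      by (intro card_mono) auto
    ultimately show ?thesis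
      by (simp add: card_indicator_sum)
  qed
  have row: "(\<Sum>a<k. of_bool (L a b)) + (\<Sum>a<k. of_bool (R a b)) \<le> (\<Sum>a<k. of_bool (F a b)) + (1::nat)"
    if b: "b < k" for b
  proof -
    let ?L = "{a. a < k \<and> L a b}" and ?R = "{a. a < k \<and> R a b}" and ?F = "{a. a < k \<and> F a b}"
    have L: "?L \<subseteq> ?F"
      using LT LB b unfolding F_def by blast
    have R: "a \<in> ?F" if "a \<in> ?R" "a0 \<in> ?R" "a0 < a" for a a0
      using that RT[of a0 b a] RB[of a0 b a] b by (auto simp: F_def)
    \<comment> \<open>A right arm misses the vertical lines of its own column but crosses those
      further right, so only the leftmost chosen one can sit at a column where the row is not free.
      If \<open>?R\<close> is empty, inserting the arbitrary \<open>Min ?R\<close> merely weakens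
      the inclusion.\<close>
    have "?L \<union> ?R \<subseteq> insert (Min ?R) ?F"
    proof
      fix a assume a: "a \<in> ?L \<union> ?R"
      show "a \<in> insert (Min ?R) ?F"
      proof (cases "a \<in> ?R")
        case True
        have "Min ?R \<in> ?R"
          using True by (intro Min_in) auto
        moreover have "Min ?R \<le> a"
          using True by (intro Min_le) auto
        ultimately show ?thesis
          using R[OF True] by (cases "Min ?R = a") auto
      qed (use a L in auto)
    qed
    then have "card (?L \<union> ?R) \<le> card ?F + 1"
      by (rule card_subset_insert_le) auto
    moreover have "card (?L \<union> ?R) = card ?L + card ?R"
      using LR by (intro card_Un_disjoint) auto
    ultimately show ?thesis
      by (simp add: card_indicator_sum)
  qed
  let ?S = "\<lambda>P. (\<Sum>a<k. \<Sum>b<k. of_bool (P a b) :: nat)"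
  have "?S T + ?S B + ?S F \<le> (\<Sum>a<k. k + 1)"
    unfolding sum.distrib[symmetric] using column by (intro sum_mono) (simp add: sum.distrib)
  moreover have "?S L + ?S R \<le> ?S F + k"
  proof -
    have "?S L + ?S R = (\<Sum>b<k. (\<Sum>a<k. of_bool (L a b)) + (\<Sum>a<k. of_bool (R a b)))"
      by (simp only: sum.distrib) (subst (1 2) sum.swap, rule refl)
    also have "\<dots> \<le> (\<Sum>b<k. (\<Sum>a<k. of_bool (F a b)) + 1)"
      using row by (intro sum_mono) auto
    also have "\<dots> = ?S F + k"
      by (simp only: sum.distrib) (subst sum.swap, simp)
    finally show ?thesis .
  qed
  ultimately show ?thesis
    by (simp add: sum.distrib power2_eq_square algebra_simps)
qed

section \<open>Independence numbers of intersection graphs\<close>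

lemma edges_intersection_graph_iff:
  "{u, v} \<in> edges (intersection_graph I s) \<longleftrightarrow> u \<in> I \<and> v \<in> I \<and> u \<noteq> v \<and> s u \<inter> s v \<noteq> {}"
  by (auto simp: intersection_graph_def doubleton_eq_iff)

lemma vertices_intersection_graph [simp]: "vertices (intersection_graph I s) = I"
  by (simp add: intersection_graph_def)

lemma finite_independent_cards:
  assumes "finite (vertices G)"
  shows "finite {card S | S. independent_set G S}"
  using assms by (auto simp: independent_set_def intro: finite_subset[of _ "card ` Pow (vertices G)"])

lemma independence_number_ge:
  assumes "finite (vertices G)" "independent_set G S"
  shows "card S \<le> independence_number G"
  unfolding independence_number_def using assms finite_independent_cards by (blast intro: Max_ge)

lemma independence_number_attained:
  assumes "finite (vertices G)"
  obtains S where "independent_set G S" "card S = independence_number G"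
proof -
  have "independent_set G {}"
    by (simp add: independent_set_def)
  then have "independence_number G \<in> {card S | S. independent_set G S}"
    unfolding independence_number_def using finite_independent_cards[OF assms] by (intro Max_in) auto
  then show ?thesis
    using that by auto
qed

text \<open>Deleting \<open>v\<close> from a maximum independent set for \<open>s'\<close> leaves a
  set independent for \<open>s\<close>, since the two families agree off \<open>v\<close>.\<close>

lemma independence_number_change_one:
  assumes "finite I" and eq: "\<And>i. i \<noteq> v \<Longrightarrow> s' i = s i"
  shows "independence_number (intersection_graph I s') \<le> independence_number (intersection_graph I s) + 1"
proof -
  obtain S where S: "independent_set (intersection_graph I s') S"
    and card: "card S = independence_number (intersection_graph I s')"
    using independence_number_attained[of "intersection_graph I s'"] assms(1) by auto
  have "independent_set (intersection_graph I s) (S - {v})"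
    using S eq by (simp add: independent_set_def edges_intersection_graph_iff) blast
  then have "card (S - {v}) \<le> independence_number (intersection_graph I s)"
    using assms(1) by (intro independence_number_ge) auto
  then show ?thesis
    using card by (simp add: card_Diff_singleton_if split: if_splits)
qed

lemma sum_blocks:
  fixes f :: "nat \<Rightarrow> 'a :: comm_monoid_add"
  shows "(\<Sum>i<n * m. f i) = (\<Sum>a<n. \<Sum>b<m. f (a * m + b))"
proof -
  have "sum f {a * m..<a * m + m} = (\<Sum>b<m. f (a * m + b))" for a
    using sum.shift_bounds_nat_ivl[of f 0 "a * m" m] by (simp add: atLeast0LessThan add.commute)
  then show ?thesis
    using sum.nat_group[of f m n] by simp
qed

section \<open>Layout of the centres and arms\<close>

definition horizontal :: "nat \<Rightarrow> bool" where
  "horizontal i \<longleftrightarrow> even (i div 2)"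

text \<open>The sign of the direction in which an arm leaves its centre. The centre is numbered
  \<open>i div 2\<close>, so it has one even and one odd arm.\<close>

definition orient :: "nat \<Rightarrow> real" where
  "orient i = (if even i then -1 else 1)"

text \<open>The vertex \<open>i\<close> lies in the cell numbered \<open>i div 4\<close>, and \<open>i mod 4 = 0, 1, 2, 3\<close> stands for
  its left, right, down and up arm. Between a vertical centre and a horizontal one, \<open>k\<close> dominates the
  offsets \<open>cell_row\<close> and \<open>cell_col\<close>, which only keep the supporting lines of different cells apart.\<close>

definition cell_col :: "nat \<Rightarrow> nat \<Rightarrow> nat" where
  "cell_col k i = i div 4 div k"

definition cell_row :: "nat \<Rightarrow> nat \<Rightarrow> nat" where
  "cell_row k i = i div 4 mod k"

text \<open>A column is \<open>2 * k\<close> wide. Its vertical lines take offsets below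
  \<open>k\<close>, one for each row, and its horizontal centres have offset \<open>k\<close>. In
  \<open>yc\<close> the vertical centres have offset 0, and the horizontal lines take the offsets
  from \<open>k\<close> to \<open>2 * k - 1\<close>, one for each column.\<close>

definition xc :: "nat \<Rightarrow> nat \<Rightarrow> nat" where
  "xc k i = 2 * k * cell_col k i + (if horizontal i then k else cell_row k i)"

definition yc :: "nat \<Rightarrow> nat \<Rightarrow> nat" where
  "yc k i = 2 * k * cell_row k i + (if horizontal i then k + cell_col k i else 0)"

definition arm :: "nat \<Rightarrow> real \<Rightarrow> nat \<Rightarrow> (real \<times> real) set" where
  "arm k r i = (let c = (real (xc k i), real (yc k i))
     in closed_segment c (c + (if horizontal i then (orient i * r, 0) else (0, orient i * r))))"

lemma mem_arm_iff:
  assumes "r > 0"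
  shows "(x, y) \<in> arm k r i \<longleftrightarrow>
    (if horizontal i
     then y = yc k i \<and> 0 \<le> orient i * (x - xc k i) \<and> orient i * (x - xc k i) \<le> r
     else x = xc k i \<and> 0 \<le> orient i * (y - yc k i) \<and> orient i * (y - yc k i) \<le> r)"
proof -
  \<comment> \<open>The one-dimensional case: from \<open>c\<close> over length \<open>r\<close> in
    direction \<open>e\<close>, the parameter of \<open>z\<close> is
    \<open>e * (z - c) / r\<close>.\<close>
  have *: "(\<exists>u. z = (1 - u) * c + u * (c + e * r) \<and> 0 \<le> u \<and> u \<le> 1) \<longleftrightarrow> 0 \<le> e * (z - c) \<and> e * (z - c) \<le> r"
    if "e * e = 1" for z c e :: real
  proof
    assume "\<exists>u. z = (1 - u) * c + u * (c + e * r) \<and> 0 \<le> u \<and> u \<le> 1"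
    then obtain u where u: "z = (1 - u) * c + u * (c + e * r)" "0 \<le> u" "u \<le> 1"
      by blast
    then have "e * (z - c) = (e * e) * (u * r)"
      by (simp add: algebra_simps)
    then show "0 \<le> e * (z - c) \<and> e * (z - c) \<le> r"
      using u assms that by (simp add: mult_left_le_one_le)
  next
    assume z: "0 \<le> e * (z - c) \<and> e * (z - c) \<le> r"
    let ?u = "e * (z - c) / r"
    have "(1 - ?u) * c + ?u * (c + e * r) = c + (e * e) * (z - c)"
      using assms by (simp add: field_simps)
    then show "\<exists>u. z = (1 - u) * c + u * (c + e * r) \<and> 0 \<le> u \<and> u \<le> 1"
      using z assms that by (intro exI[of _ ?u]) auto
  qed
  have "orient i * orient i = 1"
    by (simp add: orient_def)
  note * = *[OF this]
  have const: "(1 - u) * c + u * c = (c :: real)" for u c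
    by (simp add: algebra_simps)
  show ?thesis
    by (cases "horizontal i")
      (simp_all add: arm_def closed_segment_def *[symmetric] const, auto)
qed

lemma axis_parallel_arm:
  assumes "r > 0"
  shows "axis_parallel_segment (arm k r i)"
  unfolding axis_parallel_segment_def arm_def Let_def
  using assms by (intro exI conjI) (auto simp: orient_def zero_prod_def)

section \<open>Relative position of centres and supporting lines\<close>

lemma col_row_less:
  assumes "i < 4 * k\<^sup>2"
  shows "cell_col k i < k" "cell_row k i < k"
proof -
  have "i div 4 < k * k" "k > 0"
    using assms by (auto simp: power2_eq_square intro!: Nat.gr0I)
  then show "cell_col k i < k" "cell_row k i < k"
    by (auto simp: cell_col_def cell_row_def less_mult_imp_div_less)
qed

lemma mult_add_less_iff:
  fixes k a b c d :: nat
  assumes "a < k" "c < k"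
  shows "k * b + a = k * d + c \<longleftrightarrow> b = d \<and> a = c"
  using assms by (metis add.right_neutral div_less div_mult_self4 mod_less mod_mult_self4 gr_implies_not_zero)

lemma div_4_eq_if_div_2_eq:
  fixes i j :: nat
  assumes "i div 2 = j div 2"
  shows "i div 4 = j div 4"
  using assms div_mult2_eq[of i 2 2] div_mult2_eq[of j 2 2] by simp

lemma parity_neq_if_div_2_eq:
  fixes i j :: nat
  assumes "i div 2 = j div 2" "i \<noteq> j"
  shows "even i \<noteq> even j"
  using assms by presburger

lemma div_4_eqI: "cell_col k i = cell_col k j \<Longrightarrow> cell_row k i = cell_row k j \<Longrightarrow> i div 4 = j div 4"
  unfolding cell_col_def cell_row_def by (metis div_mult_mod_eq)

lemma div_2_eqI:
  assumes "horizontal i = horizontal j" "i div 4 = j div 4"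
  shows "i div 2 = j div 2"
proof -
  have "i div 2 = 2 * (i div 4) + i div 2 mod 2" for i :: nat
    by presburger
  then show ?thesis
    using assms by (simp add: horizontal_def even_iff_mod_2_eq_zero) (metis parity_cases)
qed

text \<open>The offset is below \<open>2 * k\<close>, so the coordinate of the line determines both
  cell coordinates, and the line carries only one centre.\<close>

lemma same_line:
  assumes "i < 4 * k\<^sup>2" "j < 4 * k\<^sup>2" "horizontal i = horizontal j"
    and "if horizontal i then yc k i = yc k j else xc k i = xc k j"
  shows "i div 2 = j div 2"
proof -
  have "cell_col k i = cell_col k j \<and> cell_row k i = cell_row k j"
  proof (cases "horizontal i")
    case True
    then have "(2 * k) * cell_row k i + cell_col k i = (2 * k) * cell_row k j + cell_col k j"
      using assms by (simp add: yc_def)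
    then show ?thesis
      using col_row_less[OF assms(1)] col_row_less[OF assms(2)]
      by (subst (asm) mult_add_less_iff) auto
  next
    case False
    then have "(2 * k) * cell_col k i + cell_row k i = (2 * k) * cell_col k j + cell_row k j"
      using assms by (simp add: xc_def)
    then show ?thesis
      using col_row_less[OF assms(1)] col_row_less[OF assms(2)]
      by (subst (asm) mult_add_less_iff) auto
  qed
  then show ?thesis
    using assms(3) by (intro div_2_eqI div_4_eqI) auto
qed

text \<open>Within a column every vertical line is left of every horizontal centre, and the next
  column starts only \<open>k\<close> further right. So comparing coordinates amounts to comparing
  columns, a tie placing the vertical line to the left.\<close>

lemma xc_less_iff:
  assumes "i < 4 * k\<^sup>2" "j < 4 * k\<^sup>2" "horizontal i" "\<not> horizontal j"
  shows "xc k j < xc k i \<longleftrightarrow> cell_col k j \<le> cell_col k i" "xc k i < xc k j \<longleftrightarrow> cell_col k i < cell_col k j"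
proof -
  have "xc k j = 2 * k * cell_col k j + cell_row k j" "xc k i = 2 * k * cell_col k i + k"
    using assms by (simp_all add: xc_def)
  note coords = this col_row_less[OF assms(1)] col_row_less[OF assms(2)]
  have "xc k j < xc k i" if "cell_col k j \<le> cell_col k i"
    using mult_le_mono2[OF that, of "2 * k"] coords by linarith
  moreover have "xc k i < xc k j" if "cell_col k i < cell_col k j"
  proof -
    have "2 * k * cell_col k i + 2 * k \<le> 2 * k * cell_col k j"
      using mult_le_mono2[OF Suc_leI[OF that], of "2 * k"] by simp
    then show ?thesis
      using coords by linarith
  qed
  \<comment> \<open>The two implications have complementary premises and incompatible conclusions,
    so both converses follow.\<close>
  ultimately show "xc k j < xc k i \<longleftrightarrow> cell_col k j \<le> cell_col k i" "xc k i < xc k j \<longleftrightarrow> cell_col k i < cell_col k j"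
    by (meson not_less order.asym)+
qed

lemma yc_less_iff:
  assumes "i < 4 * k\<^sup>2" "j < 4 * k\<^sup>2" "horizontal i" "\<not> horizontal j"
  shows "yc k j < yc k i \<longleftrightarrow> cell_row k j \<le> cell_row k i" "yc k i < yc k j \<longleftrightarrow> cell_row k i < cell_row k j"
proof -
  have "yc k j = 2 * k * cell_row k j" "yc k i = 2 * k * cell_row k i + k + cell_col k i"
    using assms by (simp_all add: yc_def)
  note coords = this col_row_less[OF assms(1)] col_row_less[OF assms(2)]
  have "yc k j < yc k i" if "cell_row k j \<le> cell_row k i"
    using mult_le_mono2[OF that, of "2 * k"] coords by linarith
  moreover have "yc k i < yc k j" if "cell_row k i < cell_row k j"
  proof -
    have "2 * k * cell_row k i + 2 * k \<le> 2 * k * cell_row k j"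
      using mult_le_mono2[OF Suc_leI[OF that], of "2 * k"] by simp
    then show ?thesis
      using coords by linarith
  qed
  ultimately show "yc k j < yc k i \<longleftrightarrow> cell_row k j \<le> cell_row k i" "yc k i < yc k j \<longleftrightarrow> cell_row k i < cell_row k j"
    by (meson not_less order.asym)+
qed

text \<open>This makes \<open>2 * k\<^sup>2\<close> a sufficient length for long arms: no two
  coordinates differ by more.\<close>

lemma coordinate_bounds:
  assumes "i < 4 * k\<^sup>2"
  shows "xc k i \<le> 2 * k\<^sup>2" "yc k i \<le> 2 * k\<^sup>2"
  using col_row_less[OF assms] mult_le_mono2[OF Suc_leI, of "cell_col k i" k "2 * k"]
    mult_le_mono2[OF Suc_leI, of "cell_row k i" k "2 * k"]
  by (auto simp: xc_def yc_def power2_eq_square)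

section \<open>Which arms meet\<close>

text \<open>By \<open>same_line\<close> the arms share a centre; being distinct, they leave it in
  opposite directions and have only the centre in common.\<close>

lemma collinear_arms_meet:
  assumes "i < 4 * k\<^sup>2" "j < 4 * k\<^sup>2" "i \<noteq> j" "horizontal i = horizontal j"
    and r: "r > 0" "r' > 0" and z: "z \<in> arm k r i" "z \<in> arm k r' j"
  shows "i div 2 = j div 2" "z = (xc k i, yc k i)"
proof -
  obtain x y where xy: "z = (x, y)"
    by (cases z)
  note xy_mem = z[unfolded xy mem_arm_iff[OF r(1)] mem_arm_iff[OF r(2)]]
  show eq: "i div 2 = j div 2"
    using assms(1-4) xy_mem by (intro same_line) (auto split: if_splits)
  then have "i div 4 = j div 4"
    by (rule div_4_eq_if_div_2_eq)
  then have "xc k i = xc k j" "yc k i = yc k j"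
    using assms(4) by (simp_all add: xc_def yc_def cell_col_def cell_row_def)
  moreover have "orient j = - orient i"
    using parity_neq_if_div_2_eq[OF eq \<open>i \<noteq> j\<close>] by (auto simp: orient_def)
  ultimately show "z = (xc k i, yc k i)"
    using xy_mem assms(4) by (auto simp: xy orient_def split: if_splits)
qed

lemma perpendicular_arms_meet_iff:
  assumes "horizontal i" "\<not> horizontal j" "r > 0" "r' > 0"
  shows "arm k r i \<inter> arm k r' j \<noteq> {} \<longleftrightarrow>
      0 \<le> orient i * (real (xc k j) - real (xc k i)) \<and> orient i * (real (xc k j) - real (xc k i)) \<le> r
    \<and> 0 \<le> orient j * (real (yc k i) - real (yc k j)) \<and> orient j * (real (yc k i) - real (yc k j)) \<le> r'"
proof -
  have "(x, y) \<in> arm k r i \<inter> arm k r' j \<longleftrightarrow> x = xc k j \<and> y = yc k i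
    \<and> 0 \<le> orient i * (real (xc k j) - real (xc k i)) \<and> orient i * (real (xc k j) - real (xc k i)) \<le> r
    \<and> 0 \<le> orient j * (real (yc k i) - real (yc k j)) \<and> orient j * (real (yc k i) - real (yc k j)) \<le> r'" for x y
    using assms by (auto simp: mem_arm_iff)
  then show ?thesis
    by (auto simp: ex_in_conv[symmetric] simp del: Int_iff)
qed

lemma centre_not_on_perpendicular_arm:
  assumes "i < 4 * k\<^sup>2" "j < 4 * k\<^sup>2" "horizontal i \<noteq> horizontal j" "r > 0"
  shows "(xc k i, yc k i) \<notin> arm k r j"
proof (cases "horizontal i")
  case True
  then have "xc k i \<noteq> xc k j"
    using xc_less_iff[of i k j] assms by linarith
  then show ?thesis
    using True assms by (simp add: mem_arm_iff)
next
  case False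
  then have "yc k i \<noteq> yc k j"
    using yc_less_iff[of j k i] assms by linarith
  then show ?thesis
    using False assms by (simp add: mem_arm_iff)
qed

text \<open>Two of three arms are parallel, so they can meet only at a shared centre. A third
  parallel arm would be a third one at a centre that has two, and a perpendicular arm avoids the
  centre.\<close>

lemma no_three_arms_meet:
  assumes "i < 4 * k\<^sup>2" "j < 4 * k\<^sup>2" "l < 4 * k\<^sup>2" "i \<noteq> j" "i \<noteq> l" "j \<noteq> l"
    and r: "r > 0" "r' > 0" "r'' > 0"
  shows "arm k r i \<inter> arm k r' j \<inter> arm k r'' l = {}"
proof -
  have *: False
    if "z \<in> arm k r i" "z \<in> arm k r' j" "z \<in> arm k r'' l" "horizontal i = horizontal j"
      and "i < 4 * k\<^sup>2" "j < 4 * k\<^sup>2" "l < 4 * k\<^sup>2" "i \<noteq> j" "i \<noteq> l" "j \<noteq> l"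
      and "r > 0" "r' > 0" "r'' > 0" for z i j l r r' r''
  proof (cases "horizontal l = horizontal i")
    case True
    then have "i div 2 = j div 2" "i div 2 = l div 2"
      using that collinear_arms_meet(1)[of i k j r r' z] collinear_arms_meet(1)[of i k l r r'' z] by auto
    then show ?thesis
      using \<open>i \<noteq> j\<close> \<open>i \<noteq> l\<close> \<open>j \<noteq> l\<close> by (metis parity_neq_if_div_2_eq)
  next
    case False
    then show ?thesis
      using that collinear_arms_meet(2)[of i k j r r' z] centre_not_on_perpendicular_arm[of i k l r'']
      by auto
  qed
  have False if "z \<in> arm k r i" "z \<in> arm k r' j" "z \<in> arm k r'' l" for z
    using *[OF that(1,2,3)] *[OF that(1,3,2)] *[OF that(2,3,1)] assms by auto
  then show ?thesis
    by blast
qed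

text \<open>Pairwise meetings need no common point, so \<open>no_three_arms_meet\<close> does not
  cover this. Two of the arms are opposite; the line of a perpendicular third arm passes strictly to
  one side of their centre, so it cannot meet both.\<close>

lemma arms_triangle_free:
  assumes "i < 4 * k\<^sup>2" "j < 4 * k\<^sup>2" "l < 4 * k\<^sup>2" "i \<noteq> j" "i \<noteq> l" "j \<noteq> l"
    and r: "\<And>i. r i > 0"
    and "arm k (r i) i \<inter> arm k (r j) j \<noteq> {}" "arm k (r i) i \<inter> arm k (r l) l \<noteq> {}"
      "arm k (r j) j \<inter> arm k (r l) l \<noteq> {}"
  shows False
proof -
  have *: False
    if less: "i < 4 * k\<^sup>2" "j < 4 * k\<^sup>2" "l < 4 * k\<^sup>2" and ne: "i \<noteq> j" "i \<noteq> l" "j \<noteq> l"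
      and meet: "arm k (r i) i \<inter> arm k (r j) j \<noteq> {}" "arm k (r i) i \<inter> arm k (r l) l \<noteq> {}"
        "arm k (r j) j \<inter> arm k (r l) l \<noteq> {}"
      and hor: "horizontal i = horizontal j" for i j l
  proof -
    have ij: "i div 2 = j div 2"
      using meet(1) collinear_arms_meet(1)[OF less(1,2) ne(1) hor r[of i] r[of j]] by blast
    have "i div 4 = j div 4"
      using ij by (rule div_4_eq_if_div_2_eq)
    then have eq: "xc k j = xc k i" "yc k j = yc k i"
      using hor by (simp_all add: xc_def yc_def cell_col_def cell_row_def)
    have opp: "orient j = - orient i"
      using parity_neq_if_div_2_eq[OF ij ne(1)] by (auto simp: orient_def)
    show False
    proof (cases "horizontal l = horizontal i")
      case True
      then have "i div 2 = l div 2"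
        using meet(2) collinear_arms_meet(1)[OF less(1,3) ne(2) True[symmetric] r[of i] r[of l]] by blast
      then show False
        using ij ne by (metis parity_neq_if_div_2_eq)
    next
      case False
      note meet_iff = perpendicular_arms_meet_iff[OF _ _ r r]
      show False
      proof (cases "horizontal i")
        case True
        \<comment> \<open>Meeting both opposite arms makes the signed distance from the centre to
          the line of \<open>l\<close> both nonnegative and nonpositive.\<close>
        then have "xc k l = xc k i"
          using meet(2,3) False hor opp eq by (auto simp: meet_iff orient_def split: if_splits)
        then show False
          using xc_less_iff[OF less(1,3)] True False by linarith
      next
        case hi: False
        then have "yc k l = yc k i"
          using meet(2,3) False hor opp eq
          by (auto simp: meet_iff Int_commute[of "arm k (r i) i"] Int_commute[of "arm k (r j) j"] orient_def
              split: if_splits)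
        then show False
          using yc_less_iff[OF less(3,1)] hi False by linarith
      qed
    qed
  qed
  show False
    using *[of i j l] *[of i l j] *[of j l i] assms by (auto simp: Int_commute)
qed

section \<open>Clique covers and fractional independence via the perfect matching\<close>

definition windmills :: "nat \<Rightarrow> (nat \<Rightarrow> real) \<Rightarrow> nat graph" where
  "windmills k r = intersection_graph {..<4 * k\<^sup>2} (\<lambda>i. arm k (r i) i)"

lemma vertices_windmills [simp]: "vertices (windmills k r) = {..<4 * k\<^sup>2}"
  by (simp add: windmills_def)

lemma windmills_in_seg_graphs:
  assumes "\<And>i. r i > 0"
  shows "windmills k r \<in> seg_graphs"
proof -
  have "\<forall>i\<in>{..<4 * k\<^sup>2}. axis_parallel_segment (arm k (r i) i)"
    using assms axis_parallel_arm by blast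
  moreover have "\<forall>i\<in>{..<4 * k\<^sup>2}. \<forall>j\<in>{..<4 * k\<^sup>2}. \<forall>l\<in>{..<4 * k\<^sup>2}.
      i \<noteq> j \<and> i \<noteq> l \<and> j \<noteq> l \<longrightarrow> arm k (r i) i \<inter> arm k (r j) j \<inter> arm k (r l) l = {}"
    using assms by (intro ballI impI no_three_arms_meet) auto
  ultimately show ?thesis
    unfolding windmills_def seg_graphs_def by blast
qed

lemma edge_windmills_iff:
  "{i, j} \<in> edges (windmills k r) \<longleftrightarrow>
     i < 4 * k\<^sup>2 \<and> j < 4 * k\<^sup>2 \<and> i \<noteq> j \<and> arm k (r i) i \<inter> arm k (r j) j \<noteq> {}"
  by (simp add: windmills_def edges_intersection_graph_iff)

lemma opposite_arms_adjacent:
  assumes "i < 2 * k\<^sup>2" "\<And>i. r i > 0"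
  shows "{2 * i, 2 * i + 1} \<in> edges (windmills k r)"
proof -
  have div4: "(2 * i + 1) div 4 = 2 * i div 4"
    by presburger
  have centre: "horizontal (2 * i + 1) = horizontal (2 * i)"
    "xc k (2 * i + 1) = xc k (2 * i)" "yc k (2 * i + 1) = yc k (2 * i)"
    unfolding xc_def yc_def cell_col_def cell_row_def div4 by (simp_all add: horizontal_def)
  have "(xc k (2 * i), yc k (2 * i)) \<in> arm k (r (2 * i)) (2 * i) \<inter> arm k (r (2 * i + 1)) (2 * i + 1)"
    using assms(2)[of "2 * i"] assms(2)[of "2 * i + 1"] centre by (simp add: mem_arm_iff)
  then show ?thesis
    using assms(1) by (auto simp: edge_windmills_iff)
qed

lemma card_clique_windmills_le:
  assumes "clique (windmills k r) C" "\<And>i. r i > 0"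
  shows "card C \<le> 2"
proof (rule ccontr)
  assume "\<not> card C \<le> 2"
  then obtain D where "D \<subseteq> C" "card D = 3"
    by (metis not_less_eq_eq numeral_2_eq_2 numeral_3_eq_3 obtain_subset_with_card_n)
  then obtain i j l where "i \<in> C" "j \<in> C" "l \<in> C" "i \<noteq> j" "i \<noteq> l" "j \<noteq> l"
    by (auto simp: card_3_iff)
  moreover from this have "{i, j} \<in> edges (windmills k r)" "{i, l} \<in> edges (windmills k r)"
    "{j, l} \<in> edges (windmills k r)"
    using assms(1) unfolding clique_def by blast+
  ultimately show False
    using arms_triangle_free[of i k j l r] assms(2) by (auto simp: edge_windmills_iff)
qed

text \<open>The pairs of opposite arms form a cover by \<open>2 * k\<^sup>2\<close> cliques; fewer
  cliques, of at most two vertices each, cannot cover \<open>4 * k\<^sup>2\<close> vertices.\<close>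

lemma clique_covering_number_windmills:
  assumes "\<And>i. r i > 0"
  shows "clique_covering_number (windmills k r) = 2 * k\<^sup>2"
  unfolding clique_covering_number_def
proof (rule Least_equality)
  let ?P = "(\<lambda>i. {2 * i, 2 * i + 1}) ` {..<2 * k\<^sup>2}"
  have "partition_on (vertices (windmills k r)) ?P"
  proof (rule partition_onI)
    show "\<Union> ?P = vertices (windmills k r)"
    proof
      show "vertices (windmills k r) \<subseteq> \<Union> ?P"
      proof
        fix v assume "v \<in> vertices (windmills k r)"
        then have "v div 2 < 2 * k\<^sup>2" "v = 2 * (v div 2) \<or> v = 2 * (v div 2) + 1"
          by (auto simp: less_mult_imp_div_less)
        then show "v \<in> \<Union> ?P"
          by blast
      qed
    qed auto
    show "disjnt p q" if pq: "p \<in> ?P" "q \<in> ?P" "p \<noteq> q" for p q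
    proof -
      obtain i where i: "p = {2 * i, 2 * i + 1}"
        using pq(1) by blast
      obtain j where j: "q = {2 * j, 2 * j + 1}"
        using pq(2) by blast
      have "i \<noteq> j"
        using pq(3) i j by blast
      then have "2 * i \<noteq> 2 * j \<and> 2 * i \<noteq> 2 * j + 1 \<and> 2 * i + 1 \<noteq> 2 * j \<and> 2 * i + 1 \<noteq> 2 * j + 1"
        by presburger
      then show ?thesis
        using i j by (simp add: disjnt_def)
    qed
  qed auto
  moreover have "clique (windmills k r) C" if "C \<in> ?P" for C
  proof -
    from that obtain i where i: "i < 2 * k\<^sup>2" "C = {2 * i, 2 * i + 1}"
      by blast
    then show ?thesis
      using opposite_arms_adjacent[OF i(1), of r] assms
      by (auto simp: clique_def insert_commute)
  qed
  moreover have "card ?P = 2 * k\<^sup>2"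
    \<comment> \<open>\<open>Min p div 2\<close> recovers \<open>i\<close> from its pair.\<close>
    by (subst card_image) (auto intro!: inj_on_inverseI[where g = "\<lambda>p. Min p div 2"])
  ultimately show "\<exists>P. partition_on (vertices (windmills k r)) P \<and> (\<forall>C\<in>P. clique (windmills k r) C) \<and> card P = 2 * k\<^sup>2"
    by blast
next
  fix n
  assume "\<exists>P. partition_on (vertices (windmills k r)) P \<and> (\<forall>C\<in>P. clique (windmills k r) C) \<and> card P = n"
  then obtain P where P: "partition_on {..<4 * k\<^sup>2} P" "\<forall>C\<in>P. clique (windmills k r) C" "card P = n"
    by auto
  have "4 * k\<^sup>2 = card (\<Union> P)"
    using partition_onD1[OF P(1)] by (metis card_lessThan)
  also have "\<dots> \<le> (\<Sum>C\<in>P. card C)"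
    by (rule card_Union_le_sum_card)
  also have "\<dots> \<le> (\<Sum>C\<in>P. 2)"
    using P(2) card_clique_windmills_le assms by (intro sum_mono) blast
  finally show "2 * k\<^sup>2 \<le> n"
    using P(3) by simp
qed

text \<open>The constant 1/2 attains the value; adding up the constraints of the matching edges
  bounds every feasible sum.\<close>

lemma fractional_independence_number_windmills:
  assumes "\<And>i. r i > 0"
  shows "fractional_independence_number (windmills k r) = 2 * (real k)\<^sup>2"
  unfolding fractional_independence_number_def
proof (rule Greatest_equality)
  show "\<exists>x. fractional_independent (windmills k r) x \<and> 2 * (real k)\<^sup>2 = (\<Sum>u\<in>vertices (windmills k r). x u)"
    by (intro exI[of _ "\<lambda>_. 1 / 2"]) (simp add: fractional_independent_def)
next
  fix t
  assume "\<exists>x. fractional_independent (windmills k r) x \<and> t = (\<Sum>u\<in>vertices (windmills k r). x u)"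
  then obtain x where x: "fractional_independent (windmills k r) x" and t: "t = (\<Sum>u<4 * k\<^sup>2. x u)"
    by auto
  have "t = (\<Sum>i<2 * k\<^sup>2. \<Sum>d<2. x (i * 2 + d))"
    using sum_blocks[of x "2 * k\<^sup>2" 2] t by (simp add: mult.assoc mult.commute)
  also have "\<dots> = (\<Sum>i<2 * k\<^sup>2. x (2 * i) + x (2 * i + 1))"
    by (simp add: numeral_2_eq_2 mult.commute)
  also have "\<dots> \<le> (\<Sum>i<2 * k\<^sup>2. 1)"
    using x opposite_arms_adjacent assms unfolding fractional_independent_def by (intro sum_mono) blast
  finally show "t \<le> 2 * (real k)\<^sup>2"
    by simp
qed

text \<open>An independent set has at most one arm of each centre. The bound serves
  \<open>k = 1\<close>, where \<open>k\<^sup>2 + 2 * k\<close> exceeds the target value.\<close>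

lemma card_independent_windmills_le:
  assumes S: "independent_set (windmills k r) S" and r: "\<And>i. r i > 0"
  shows "card S \<le> 2 * k\<^sup>2"
proof -
  have "inj_on (\<lambda>i. i div 2) S"
  proof (rule inj_onI, rule ccontr)
    fix i j assume ij: "i \<in> S" "j \<in> S" "i div 2 = j div 2" "i \<noteq> j"
    define c where "c = i div 2"
    have "i = 2 * c \<and> j = 2 * c + 1 \<or> j = 2 * c \<and> i = 2 * c + 1"
      using parity_neq_if_div_2_eq[OF ij(3,4)] ij(3) unfolding c_def
      by (metis even_two_times_div_two odd_two_times_div_two_succ)
    then have "{i, j} = {2 * c, 2 * c + 1}"
      by auto
    moreover have "c < 2 * k\<^sup>2"
      using S ij(1) by (auto simp: c_def independent_set_def less_mult_imp_div_less)
    then have "{2 * c, 2 * c + 1} \<in> edges (windmills k r)"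
      using opposite_arms_adjacent r by blast
    moreover have "{i, j} \<notin> edges (windmills k r)"
      using S ij(1,2) by (simp add: independent_set_def)
    ultimately show False
      by simp
  qed
  moreover have "(\<lambda>i. i div 2) ` S \<subseteq> {..<2 * k\<^sup>2}"
    using S by (auto simp: independent_set_def less_mult_imp_div_less)
  ultimately show ?thesis
    using card_inj_on_le[of "\<lambda>i. i div 2" S "{..<2 * k\<^sup>2}"] by simp
qed

section \<open>Long arms and short arms\<close>

text \<open>The parity conditions say that each arm points towards the supporting line of the other;
  by \<open>coordinate_bounds\<close> it is long enough to reach it.\<close>

lemma long_arms_meet:
  assumes "i < 4 * k\<^sup>2" "j < 4 * k\<^sup>2" "horizontal i" "\<not> horizontal j" "k > 0"
    and "even i \<longleftrightarrow> cell_col k j \<le> cell_col k i" "odd j \<longleftrightarrow> cell_row k j \<le> cell_row k i"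
  shows "arm k (2 * k\<^sup>2) i \<inter> arm k (2 * k\<^sup>2) j \<noteq> {}"
proof -
  have "real (xc k i) \<le> 2 * k\<^sup>2" "real (xc k j) \<le> 2 * k\<^sup>2" "real (yc k i) \<le> 2 * k\<^sup>2" "real (yc k j) \<le> 2 * k\<^sup>2"
    using coordinate_bounds[OF assms(1)] coordinate_bounds[OF assms(2)] by linarith+
  then show ?thesis
    using assms xc_less_iff[of i k j] yc_less_iff[of i k j]
    by (subst perpendicular_arms_meet_iff) (auto simp: orient_def not_le intro: less_imp_le)
qed

text \<open>Coordinates of centres are integers, so a perpendicular line that misses a centre is at
  distance at least 1 from it; parallel arms meet only if they share a centre.\<close>

lemma short_arms_disjoint:
  assumes "i < 4 * k\<^sup>2" "j < 4 * k\<^sup>2" "i div 2 \<noteq> j div 2"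
  shows "arm k (1 / 2) i \<inter> arm k (1 / 2) j = {}"
proof -
  have perp: "arm k (1 / 2) i \<inter> arm k (1 / 2) j = {}"
    if "i < 4 * k\<^sup>2" "j < 4 * k\<^sup>2" "horizontal i" "\<not> horizontal j" for i j
  proof -
    have "xc k i \<noteq> xc k j"
      using xc_less_iff[OF that] by linarith
    then have "\<bar>real (xc k j) - real (xc k i)\<bar> \<ge> 1"
      by linarith
    then have "\<not> (0 \<le> orient i * (real (xc k j) - real (xc k i)) \<and> orient i * (real (xc k j) - real (xc k i)) \<le> 1 / 2)"
      by (auto simp: orient_def)
    then show ?thesis
      using perpendicular_arms_meet_iff[OF that(3,4), of "1 / 2" "1 / 2" k] by auto
  qed
  show ?thesis
  proof (cases "horizontal i = horizontal j")
    case True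
    then show ?thesis
      using collinear_arms_meet(1)[of i k j "1 / 2" "1 / 2"] assms by fastforce
  next
    case False
    then show ?thesis
      using perp[of i j] perp[of j i] assms by (cases "horizontal i") (auto simp: Int_commute)
  qed
qed

lemma card_independent_long_windmills_le:
  assumes "k > 0" and S: "independent_set (windmills k (\<lambda>_. 2 * (real k)\<^sup>2)) S"
  shows "card S \<le> k\<^sup>2 + 2 * k"
proof -
  \<comment> \<open>The index of arm \<open>d\<close> in the cell of column \<open>a\<close> and row
    \<open>b\<close>, inverse to \<open>cell_col\<close>, \<open>cell_row\<close> and the remainder
    modulo 4.\<close>
  define v where "v a b d = (a * k + b) * 4 + d" for a b d :: nat
  have v: "v a b d div 4 = a * k + b" if "d < 4" for a b d
    using that by (simp add: v_def)
  have less: "v a b d < 4 * k\<^sup>2" if "a < k" "b < k" "d < 4" for a b d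
  proof -
    have "a * k + b < k * k"
      using that mult_le_mono1[OF Suc_leI[OF \<open>a < k\<close>], of k] by simp
    then show ?thesis
      using that by (simp add: v_def power2_eq_square)
  qed
  have cr: "cell_col k (v a b d) = a" "cell_row k (v a b d) = b" if "b < k" "d < 4" for a b d
    using that v by (simp_all add: cell_col_def cell_row_def)
  have even: "even (v a b d) \<longleftrightarrow> even d" for a b d
    by (simp add: v_def)
  have "v a b d div 2 = 2 * (a * k + b) + d div 2" for a b d
    by (simp add: v_def)
  then have hor: "horizontal (v a b d) \<longleftrightarrow> even (d div 2)" for a b d
    by (simp add: horizontal_def)
  have disjoint: "arm k (2 * (real k)\<^sup>2) i \<inter> arm k (2 * (real k)\<^sup>2) j = {}"
    if "i \<in> S" "j \<in> S" "i \<noteq> j" for i j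
    using S that by (auto simp: independent_set_def edge_windmills_iff)
  have perp: "\<not> (v a b d \<in> S \<and> v a' b' d' \<in> S)"
    if "even d \<longleftrightarrow> a' \<le> a" "odd d' \<longleftrightarrow> b' \<le> b" "even (d div 2)" "odd (d' div 2)"
      "d < 4" "d' < 4" "a < k" "b < k" "a' < k" "b' < k" for a b d a' b' d'
  proof
    assume in_S: "v a b d \<in> S \<and> v a' b' d' \<in> S"
    have "v a b d \<noteq> v a' b' d'"
      using that hor by metis
    moreover have "arm k (2 * k\<^sup>2) (v a b d) \<inter> arm k (2 * k\<^sup>2) (v a' b' d') \<noteq> {}"
      using that \<open>k > 0\<close> by (intro long_arms_meet) (simp_all add: hor less cr even)
    ultimately show False
      using disjoint[of "v a b d" "v a' b' d'"] in_S by simp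
  qed
  have opp: "\<not> (v a b (2 * d) \<in> S \<and> v a b (2 * d + 1) \<in> S)" for a b d
  proof
    have "v a b (2 * d) = 2 * ((a * k + b) * 2 + d)" "v a b (2 * d + 1) = 2 * ((a * k + b) * 2 + d) + 1"
      by (simp_all add: v_def)
    moreover assume in_S: "v a b (2 * d) \<in> S \<and> v a b (2 * d + 1) \<in> S"
    ultimately show False
      using opposite_arms_adjacent[of "(a * k + b) * 2 + d" k "\<lambda>_. 2 * (real k)\<^sup>2"] S \<open>k > 0\<close>
      by (auto simp: independent_set_def)
  qed
  let ?X = "\<lambda>d a b. a < k \<and> b < k \<and> v a b d \<in> S"
  have "card S = (\<Sum>i<4 * k\<^sup>2. of_bool (i \<in> S))"
    using S by (auto simp: card_indicator_sum independent_set_def intro!: arg_cong[where f = card])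
  also have "\<dots> = (\<Sum>i<k * k * 4. of_bool (i \<in> S))"
    by (simp add: power2_eq_square mult.commute)
  also have "\<dots> = (\<Sum>a<k. \<Sum>b<k. \<Sum>d<4. of_bool (v a b d \<in> S))"
    by (simp only: sum_blocks v_def)
  \<comment> \<open>The order 0, 1, 3, 2 is left, right, up, down, as in the counting bound.
    \<open>?X\<close> carries the index bounds that \<open>perp\<close> asks for.\<close>
  also have "\<dots> = (\<Sum>a<k. \<Sum>b<k. of_bool (?X 0 a b) + of_bool (?X 1 a b) + of_bool (?X 3 a b) + of_bool (?X 2 a b))"
    by (simp add: numeral_eq_Suc add_ac)
  also have "\<dots> \<le> k\<^sup>2 + 2 * k"
  proof (rule no_crossing_arms_bound)
    show "\<not> (?X 0 a b \<and> ?X 1 a b)" for a b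
      using opp[of a b 0] by simp
    show "\<not> (?X 3 a b \<and> ?X 2 a b)" for a b
      using opp[of a b 1] by (auto simp: numeral_3_eq_3 numeral_2_eq_2)
  next
    fix a b a' b'
    show "?X 0 a b \<Longrightarrow> ?X 3 a' b' \<Longrightarrow> a' \<le> a \<Longrightarrow> b' \<le> b \<Longrightarrow> False"
      using perp[of 0 a' a 3 b' b] by simp
    show "?X 0 a b \<Longrightarrow> ?X 2 a' b' \<Longrightarrow> a' \<le> a \<Longrightarrow> b < b' \<Longrightarrow> False"
      using perp[of 0 a' a 2 b' b] by simp
    show "?X 1 a b \<Longrightarrow> ?X 3 a' b' \<Longrightarrow> a < a' \<Longrightarrow> b' \<le> b \<Longrightarrow> False"
      using perp[of 1 a' a 3 b' b] by simp
    show "?X 1 a b \<Longrightarrow> ?X 2 a' b' \<Longrightarrow> a < a' \<Longrightarrow> b < b' \<Longrightarrow> False"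
      using perp[of 1 a' a 2 b' b] by simp
  qed
  finally show ?thesis .
qed

section \<open>Interpolation between long and short arms\<close>

lemma ex_windmills_independence_number:
  assumes "k > 0" "independence_number (windmills k (\<lambda>_. 2 * (real k)\<^sup>2)) \<le> n" "n \<le> 2 * k\<^sup>2"
  obtains r where "\<And>i. r i > 0" "independence_number (windmills k r) = n"
proof -
  \<comment> \<open>In \<open>r m\<close> the first \<open>m\<close> arms are short, so
    \<open>r m\<close> and \<open>r (Suc m)\<close> differ at one arm only.\<close>
  define r :: "nat \<Rightarrow> nat \<Rightarrow> real" where "r m i = (if i < m then 1 / 2 else 2 * (real k)\<^sup>2)" for m i
  let ?\<alpha> = "\<lambda>m. independence_number (windmills k (r m))"
  have step: "?\<alpha> (Suc m) \<le> ?\<alpha> m + 1" for m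
    unfolding windmills_def by (rule independence_number_change_one[where v = m]) (auto simp: r_def)
  have "n \<le> ?\<alpha> (4 * k\<^sup>2)"
  proof -
    \<comment> \<open>One arm from each centre; once all arms are short, these are pairwise
      disjoint.\<close>
    let ?S = "(\<lambda>i. 2 * i) ` {..<2 * k\<^sup>2}"
    have "independent_set (windmills k (r (4 * k\<^sup>2))) ?S"
      using short_arms_disjoint[of "2 * u" k "2 * v" for u v]
      by (fastforce simp: independent_set_def edge_windmills_iff r_def)
    then have "card ?S \<le> ?\<alpha> (4 * k\<^sup>2)"
      by (intro independence_number_ge) auto
    then show ?thesis
      using assms(3) by (simp add: card_image inj_on_def)
  qed
  moreover have "?\<alpha> 0 \<le> n"
    using assms(2) unfolding r_def by simp
  ultimately obtain m where m: "?\<alpha> m = n"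
  proof -
    \<comment> \<open>A discrete intermediate value argument: before \<open>M\<close> the value is
      below \<open>n\<close>, and one step adds at most 1, so it cannot jump over
      \<open>n\<close>.\<close>
    define M where "M = (LEAST m. n \<le> ?\<alpha> m)"
    have M: "n \<le> ?\<alpha> M"
      unfolding M_def using \<open>n \<le> ?\<alpha> (4 * k\<^sup>2)\<close> by (rule LeastI)
    have "?\<alpha> M \<le> n"
    proof (cases M)
      case (Suc m)
      then have "\<not> n \<le> ?\<alpha> m"
        unfolding M_def by (intro not_less_Least) simp
      then show ?thesis
        using step[of m] Suc by simp
    qed (use \<open>?\<alpha> 0 \<le> n\<close> in simp)
    then show ?thesis
      using M that by simp
  qed
  moreover have "r m i > 0" for i
    using \<open>k > 0\<close> by (simp add: r_def)
  ultimately show ?thesis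
    using that by blast
qed

theorem theorem10:
  fixes k :: nat
  assumes "k \<ge> 1"
  shows "\<exists>G :: nat graph. G \<in> seg_graphs
    \<and> card (vertices G) = 4 * k ^ 2
    \<and> clique_covering_number G = 2 * k ^ 2
    \<and> fractional_independence_number G = 2 * real k ^ 2
    \<and> independence_number G = k ^ 2 + 3 * k - 2"
proof -
  have k: "k > 0"
    using assms by simp
  let ?G = "windmills k (\<lambda>_. 2 * (real k)\<^sup>2)"
  obtain S where S: "independent_set ?G S" "card S = independence_number ?G"
    using independence_number_attained[of ?G] by auto
  have "card S \<le> k\<^sup>2 + 2 * k" "card S \<le> 2 * k\<^sup>2"
    using card_independent_long_windmills_le[OF k S(1)] card_independent_windmills_le[OF S(1)] k by auto
  \<comment> \<open>For \<open>k = 1\<close> the target is 2, and the bound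
    \<open>2 * k\<^sup>2\<close> gives it; from \<open>k = 2\<close> on,
    \<open>2 * k \<le> 3 * k - 2\<close> and the other bound does.\<close>
  moreover have "k = 1 \<or> 2 \<le> k"
    using k by linarith
  ultimately have "independence_number ?G \<le> k\<^sup>2 + 3 * k - 2"
    using S(2) by auto
  \<comment> \<open>The difference is \<open>(k - 1) * (k - 2)\<close>, which is
    \<open>l * l - l\<close> for \<open>k = Suc l\<close>.\<close>
  moreover have "k\<^sup>2 + 3 * k - 2 \<le> 2 * k\<^sup>2"
  proof -
    obtain l where "k = Suc l"
      using k gr0_implies_Suc by blast
    moreover have "l \<le> l * l"
      by (cases l) auto
    ultimately show ?thesis
      by (simp add: power2_eq_square algebra_simps)
  qed
  ultimately obtain r where r: "\<And>i. r i > 0" "independence_number (windmills k r) = k\<^sup>2 + 3 * k - 2"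
    using ex_windmills_independence_number[OF k] by blast
  show ?thesis
    using r windmills_in_seg_graphs[of r k] clique_covering_number_windmills[of r k]
      fractional_independence_number_windmills[of r k]
    by (intro exI[of _ "windmills k r"]) simp
qed

end
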